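(* Let $n,d\ge1$ and let $S$ be a finite set of points in $\mathbb{R}^n$ such that $\dim Pos_{n,2d}(S)>\dim Sq_{n,2d}(S)$. Let $l_1,\dots,l_k$ be linear functionals on $P_{n,2d}$ forming a basis of the set of extra linear constraints satisfied by $Sq_{n,2d}(S)$ (as defined in the context), and set, for $p\in P_{n,2d}$, $$R_S(p)=\sum_{i=1}^k l_i(p)^2,\qquad M_S(p)=\sum_{s\in S}p(s),\qquad T(p)=\int_{\mathbb{S}^{n-1}}p\,d\sigma .$$ Then there exists $\alpha>0$ such that for all $p\in Sq_{n,2d}$ $$\alpha\, M_S(p)\,T(p)-R_S(p)\ \ge\ 0 .$$
   Context: $P_{n,m}$ denotes the real vector space of forms in $n$ variables of degree $m$ with real coefficients. $Pos_{n,2d}=\{p\in P_{n,2d} : p(x)\ge0\ \forall x\in\mathbb{R}^n\}$ and $Sq_{n,2d}=\{p\in P_{n,2d} : p=\sum q_i^2 \text{ (finite sum) for some } q_i\in P_{n,d}\}$. Points of $S$ are nonzero vectors, distinct as points of $\mathbb{RP}^{n-1}$. $Pos_{n,2d}(S)$ and $Sq_{n,2d}(S)$ are the subsets of forms in $Pos_{n,2d}$, respectively $Sq_{n,2d}$, vanishing at every $s\in S$; the dimension of a convex cone is the dimension of its linear span. $\sigma$ is the uniform (rotation invariant) probability measure on the unit sphere $\mathbb{S}^{n-1}$. Extra linear constraints: these are the linear constraints satisfied by the forms in $Sq_{n,2d}(S)$ but not by all forms in $Pos_{n,2d}(S)$. That $l_1,\dots,l_k$ form a basis of them means: each $l_i$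 is a linear functional on $P_{n,2d}$ vanishing on $Sq_{n,2d}(S)$, and the restrictions of $l_1,\dots,l_k$ to the linear span of $Pos_{n,2d}(S)$ form a basis of the space of linear functionals on that span which vanish on $Sq_{n,2d}(S)$. In particular, for $p\in Sq_{n,2d}$, if $p(s)=0$ for all $s\in S$ then $l_1(p)=\dots=l_k(p)=0$. *)

theory Defs
  imports "HOL-Analysis.Analysis" "HOL-Probability.Probability_Measure" "HOL-Library.Poly_Mapping"
begin

text \<open>
  A polynomial in finitely many variables, indexed by the type \<^typ>\<open>'n\<close>, is a finitely supported
  map from exponent vectors to coefficients. The arithmetic is that of \<^theory>\<open>HOL-Library.Poly_Mapping\<close>;
  only the structure of a real vector space has to be added.
\<close>

type_synonym 'n rpoly = "('n \<Rightarrow>\<^sub>0 nat) \<Rightarrow>\<^sub>0 real"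

instantiation poly_mapping :: (type, real_vector) real_vector
begin

lift_definition scaleR_poly_mapping :: "real \<Rightarrow> ('a \<Rightarrow>\<^sub>0 'b) \<Rightarrow> 'a \<Rightarrow>\<^sub>0 'b"
  is "\<lambda>c f k. c *\<^sub>R f k"
  by (erule finite_subset[rotated]) auto

instance
  by (intro_classes; transfer) (auto simp: fun_eq_iff scaleR_add_right scaleR_add_left)

end

definition peval :: "'n::finite rpoly \<Rightarrow> real ^ 'n \<Rightarrow> real" where
  "peval p x = (\<Sum>m\<in>Poly_Mapping.keys p.
     Poly_Mapping.lookup p m * (\<Prod>i\<in>UNIV. (x $ i) ^ Poly_Mapping.lookup m i))"

text \<open>\<open>P\<^bsub>n,m\<^esub>\<close> with \<open>n = CARD('n)\<close>; it contains the zero polynomial for every \<open>m\<close>.\<close>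

definition forms :: "nat \<Rightarrow> 'n::finite rpoly set" where
  "forms m = {p. \<forall>e\<in>Poly_Mapping.keys p. (\<Sum>i\<in>UNIV. Poly_Mapping.lookup e i) = m}"

text \<open>\<open>Pos d\<close> is \<open>Pos\<^bsub>n,2d\<^esub>\<close> and \<open>Sq d\<close> is \<open>Sq\<^bsub>n,2d\<^esub>\<close>: the argument is half the degree.\<close>

definition Pos :: "nat \<Rightarrow> 'n::finite rpoly set" where
  "Pos d = {p \<in> forms (2 * d). \<forall>x. peval p x \<ge> 0}"

definition Sq :: "nat \<Rightarrow> 'n::finite rpoly set" where
  "Sq d = {p \<in> forms (2 * d). \<exists>(N::nat) q. (\<forall>j<N. q j \<in> forms d) \<and> p = (\<Sum>j<N. (q j)\<^sup>2)}"

definition vanishing :: "'n::finite rpoly set \<Rightarrow> (real ^ 'n) set \<Rightarrow> 'n rpoly set" where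
  "vanishing C S = {p \<in> C. \<forall>s\<in>S. peval p s = 0}"

abbreviation Pos_on :: "nat \<Rightarrow> (real ^ 'n::finite) set \<Rightarrow> 'n rpoly set" where
  "Pos_on d S \<equiv> vanishing (Pos d) S"

abbreviation Sq_on :: "nat \<Rightarrow> (real ^ 'n::finite) set \<Rightarrow> 'n rpoly set" where
  "Sq_on d S \<equiv> vanishing (Sq d) S"

text \<open>Finite sets of nonzero vectors representing pairwise distinct points of real projective
  space, a point of which is a line \<^term>\<open>span {s}\<close>.\<close>

definition projective_points :: "(real ^ 'n::finite) set \<Rightarrow> bool" where
  "projective_points S \<longleftrightarrow> finite S \<and> 0 \<notin> S \<and> inj_on (\<lambda>s. span {s}) S"

text \<open>Linear functionals on a subspace \<open>V\<close>; values outside \<open>V\<close> are irrelevant.\<close>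

definition linear_functional_on :: "'a::real_vector set \<Rightarrow> ('a \<Rightarrow> real) \<Rightarrow> bool" where
  "linear_functional_on V l \<longleftrightarrow>
     (\<forall>u\<in>V. \<forall>v\<in>V. l (u + v) = l u + l v) \<and> (\<forall>c. \<forall>u\<in>V. l (c *\<^sub>R u) = c * l u)"

text \<open>The last two conjuncts say that the restrictions of \<open>l 1, \<dots>, l k\<close> to the span \<open>W\<close> of
  \<open>Pos_on d S\<close> are linearly independent, and that they span the space of linear functionals on \<open>W\<close>
  which vanish on \<open>Sq_on d S\<close>.\<close>

definition extra_constraints_basis ::
  "nat \<Rightarrow> (real ^ 'n::finite) set \<Rightarrow> nat \<Rightarrow> (nat \<Rightarrow> 'n rpoly \<Rightarrow> real) \<Rightarrow> bool" where
  "extra_constraints_basis d S k l \<longleftrightarrow>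
     (\<forall>i\<in>{1..k}. linear_functional_on (forms (2 * d)) (l i) \<and> (\<forall>p\<in>Sq_on d S. l i p = 0)) \<and>
     (\<forall>c. (\<forall>p\<in>span (Pos_on d S). (\<Sum>i=1..k. c i * l i p) = 0) \<longrightarrow> (\<forall>i\<in>{1..k}. c i = 0)) \<and>
     (\<forall>f. linear_functional_on (span (Pos_on d S)) f \<and> (\<forall>p\<in>Sq_on d S. f p = 0) \<longrightarrow>
        (\<exists>c. \<forall>p\<in>span (Pos_on d S). f p = (\<Sum>i=1..k. c i * l i p)))"

text \<open>Invariance is required under the full orthogonal group, so that the measure is determined
  also on the two-point sphere of the real line.\<close>

definition uniform_sphere_measure :: "(real ^ 'n::finite) measure \<Rightarrow> bool" where
  "uniform_sphere_measure \<sigma> \<longleftrightarrow>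
     prob_space \<sigma> \<and> sets \<sigma> = sets (restrict_space borel (sphere 0 1)) \<and>
     (\<forall>f. orthogonal_transformation f \<longrightarrow> distr \<sigma> \<sigma> f = \<sigma>)"

definition R_S :: "nat \<Rightarrow> (nat \<Rightarrow> 'n::finite rpoly \<Rightarrow> real) \<Rightarrow> 'n rpoly \<Rightarrow> real" where
  "R_S k l p = (\<Sum>i=1..k. (l i p)\<^sup>2)"

definition M_S :: "(real ^ 'n::finite) set \<Rightarrow> 'n rpoly \<Rightarrow> real" where
  "M_S S p = (\<Sum>s\<in>S. peval p s)"

definition sphere_avg :: "(real ^ 'n::finite) measure \<Rightarrow> 'n rpoly \<Rightarrow> real" where
  "sphere_avg \<sigma> p = (\<integral>x. peval p x \<partial>\<sigma>)"

text \<open>Existence of the uniform measure: project the uniform measure of the punctured unit ball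
  radially to the sphere.\<close>

lemma nn_integral_lborel_shift:
  fixes g :: "'a::euclidean_space \<Rightarrow> ennreal"
  assumes [measurable]: "g \<in> borel_measurable borel" and c: "\<bar>c\<bar> = 1"
  shows "(\<integral>\<^sup>+x. g (t + c *\<^sub>R x) \<partial>lborel) = (\<integral>\<^sup>+x. g x \<partial>lborel)"
proof -
  have "c \<noteq> 0" using c by auto
  from lborel_affine[OF this, of t] have "lborel = distr lborel borel (\<lambda>x. t + c *\<^sub>R x)"
    using c by (simp add: density_1)
  then have "(\<integral>\<^sup>+x. g x \<partial>lborel) = (\<integral>\<^sup>+x. g x \<partial>distr lborel borel (\<lambda>x. t + c *\<^sub>R x))" by simp
  also have "\<dots> = (\<integral>\<^sup>+x. g (t + c *\<^sub>R x) \<partial>lborel)" by (rule nn_integral_distr) auto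
  finally show ?thesis by simp
qed

lemma distr_lborel_orthogonal:
  fixes f :: "'a::euclidean_space \<Rightarrow> 'a"
  assumes f: "orthogonal_transformation f"
  shows "distr lborel borel f = lborel"
proof (rule measure_eqI)
  have lin: "linear f" using f by (simp add: orthogonal_transformation_linear)
  have fm[measurable]: "f \<in> borel_measurable borel"
    using linear_continuous_on[of f] lin
    by (intro borel_measurable_continuous_onI) (simp add: linear_conv_bounded_linear)
  have inv: "f (inv f y) = y" for y
    using orthogonal_transformation_surj[OF f] by (simp add: surj_f_inv_f)
  define B where "B = ball (0::'a) 1"
  define b where "b x = (indicator B x :: ennreal)" for x
  have [measurable]: "B \<in> sets borel" by (simp add: B_def)
  have [measurable]: "b \<in> borel_measurable borel" unfolding b_def by measurable
  have fB: "b (f x) = b x" for x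
    using orthogonal_transformation_norm[OF f] by (simp add: b_def B_def indicator_def)
  have b_int: "(\<integral>\<^sup>+x. b x \<partial>lborel) = emeasure lborel B" by (simp add: b_def)
  have Bpos: "emeasure lborel B \<noteq> 0" "emeasure lborel B \<noteq> \<infinity>"
    using content_ball_pos[of 1 "0::'a"] emeasure_lborel_ball_finite[of "0::'a" 1]
    by (auto simp: emeasure_eq_ennreal_measure less_top B_def)
  fix A assume "A \<in> sets (distr lborel borel f)"
  then have A[measurable]: "A \<in> sets borel" by simp
  define a where "a x = (indicator A x :: ennreal)" for x
  have [measurable]: "a \<in> borel_measurable borel" unfolding a_def by measurable
  have "emeasure lborel B * emeasure lborel A = (\<integral>\<^sup>+y. a y * (\<integral>\<^sup>+x. b (f x) \<partial>lborel) \<partial>lborel)"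
    by (simp add: nn_integral_multc fB b_int) (simp add: a_def mult.commute)
  also have "\<dots> = (\<integral>\<^sup>+y. a y * (\<integral>\<^sup>+x. b (f x - y) \<partial>lborel) \<partial>lborel)"
  proof (rule nn_integral_cong)
    fix y
    have "(\<integral>\<^sup>+x. b (f x) \<partial>lborel) = (\<integral>\<^sup>+x. b (f x - y) \<partial>lborel)"
      using nn_integral_lborel_shift[of "\<lambda>x. b (f x)" 1 "- inv f y"] lin
      by (simp add: linear_diff inv)
    then show "a y * (\<integral>\<^sup>+x. b (f x) \<partial>lborel) = a y * (\<integral>\<^sup>+x. b (f x - y) \<partial>lborel)" by simp
  qed
  also have "\<dots> = (\<integral>\<^sup>+y. \<integral>\<^sup>+x. a y * b (f x - y) \<partial>lborel \<partial>lborel)"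
    by (simp add: nn_integral_cmult)
  also have "\<dots> = (\<integral>\<^sup>+x. \<integral>\<^sup>+y. a y * b (f x - y) \<partial>lborel \<partial>lborel)"
    by (rule lborel_pair.Fubini') measurable
  also have "\<dots> = (\<integral>\<^sup>+x. \<integral>\<^sup>+z. a (f x - z) * b z \<partial>lborel \<partial>lborel)"
  proof (rule nn_integral_cong)
    fix x
    show "(\<integral>\<^sup>+y. a y * b (f x - y) \<partial>lborel) = (\<integral>\<^sup>+z. a (f x - z) * b z \<partial>lborel)"
      using nn_integral_lborel_shift[of "\<lambda>y. a y * b (f x - y)" "-1" "f x"] by simp
  qed
  also have "\<dots> = (\<integral>\<^sup>+z. \<integral>\<^sup>+x. a (f x - z) * b z \<partial>lborel \<partial>lborel)"
    by (rule lborel_pair.Fubini') measurable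
  also have "\<dots> = (\<integral>\<^sup>+z. (\<integral>\<^sup>+x. a (f x) \<partial>lborel) * b z \<partial>lborel)"
  proof (rule nn_integral_cong)
    fix z
    show "(\<integral>\<^sup>+x. a (f x - z) * b z \<partial>lborel) = (\<integral>\<^sup>+x. a (f x) \<partial>lborel) * b z"
      using nn_integral_lborel_shift[of "\<lambda>x. a (f x)" 1 "- inv f z"] lin
      by (simp add: nn_integral_multc linear_diff inv)
  qed
  also have "\<dots> = emeasure lborel B * (\<integral>\<^sup>+x. a (f x) \<partial>lborel)"
    by (subst nn_integral_cmult) (simp_all add: b_int mult.commute)
  also have "(\<integral>\<^sup>+x. a (f x) \<partial>lborel) = emeasure (distr lborel borel f) A"
  proof -
    have "(\<integral>\<^sup>+x. a (f x) \<partial>lborel) = (\<integral>\<^sup>+x. a x \<partial>distr lborel borel f)"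
      by (rule nn_integral_distr[symmetric]) auto
    then show ?thesis by (simp add: a_def)
  qed
  finally show "emeasure (distr lborel borel f) A = emeasure lborel A"
    using Bpos by (simp add: ennreal_mult_cancel_left)
qed simp

lemma uniform_sphere_measure_exists: "\<exists>\<sigma> :: (real ^ 'n::finite) measure. uniform_sphere_measure \<sigma>"
proof -
  define B :: "(real ^ 'n) set" where "B = ball 0 1 - {0}"
  define U where "U = uniform_measure lborel B"
  define N :: "(real ^ 'n) measure" where "N = restrict_space borel (sphere 0 1)"
  define a :: "real ^ 'n" where "a = axis undefined 1"
  define g :: "real ^ 'n \<Rightarrow> real ^ 'n" where "g x = (if x = 0 then a else x /\<^sub>R norm x)" for x
  have B[measurable]: "B \<in> sets borel" by (simp add: B_def)
  have "emeasure lborel B = emeasure lborel (ball (0::real ^ 'n) 1)"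
    unfolding B_def by (subst emeasure_Diff_null_set) auto
  then have B0: "emeasure lborel B \<noteq> 0" "emeasure lborel B \<noteq> \<infinity>"
    using content_ball_pos[of 1 "0::real ^ 'n"] emeasure_lborel_ball_finite[of "0::real ^ 'n" 1]
    by (auto simp: emeasure_eq_ennreal_measure less_top)
  have sU[simp, measurable_cong]: "sets U = sets borel" by (simp add: U_def)
  have spU[simp]: "space U = UNIV" by (simp add: U_def)
  have eU: "emeasure U A = emeasure lborel (B \<inter> A) / emeasure lborel B" if "A \<in> sets borel" for A
    using that by (simp add: U_def)
  interpret U: prob_space U unfolding U_def by (rule prob_space_uniform_measure[OF B0])
  have ga: "g x \<in> sphere 0 1" for x by (auto simp: g_def a_def)
  have "g \<in> borel_measurable borel" unfolding g_def by measurable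
  then have gN[measurable]: "g \<in> measurable U N"
    unfolding N_def by (intro measurable_restrict_space2) (use ga in auto)
  have U_inv: "distr U U f = U" if f: "orthogonal_transformation f" and fm: "f \<in> borel_measurable borel" for f
  proof (rule measure_eqI)
    fix A assume "A \<in> sets (distr U U f)"
    then have A: "A \<in> sets borel" by simp
    have fA: "f -` A \<in> sets borel" using measurable_sets[OF fm A] by simp
    have "f -` B = B"
      using orthogonal_transformation_norm[OF f] by (auto simp: B_def) (metis norm_eq_zero)+
    then have eq: "f -` (B \<inter> A) = B \<inter> f -` A" by (simp only: vimage_Int)
    have "emeasure lborel (B \<inter> A) = emeasure (distr lborel borel f) (B \<inter> A)"
      by (simp add: distr_lborel_orthogonal[OF f])
    also have "\<dots> = emeasure lborel (B \<inter> f -` A)"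
      using A fm by (subst emeasure_distr) (auto simp: eq simp del: vimage_Int)
    finally have "emeasure lborel (B \<inter> A) = emeasure lborel (B \<inter> f -` A)" .
    then show "emeasure (distr U U f) A = emeasure U A"
      using A fA fm by (subst emeasure_distr) (auto simp: eU cong: measurable_cong_sets)
  qed simp
  have "uniform_sphere_measure (distr U N g)"
    unfolding uniform_sphere_measure_def
  proof (intro conjI allI impI)
    show "prob_space (distr U N g)" by (rule U.prob_space_distr) simp
    show "sets (distr U N g) = sets (restrict_space borel (sphere 0 1))" by (simp add: N_def)
    fix f :: "real ^ 'n \<Rightarrow> real ^ 'n" assume f: "orthogonal_transformation f"
    have lin: "linear f" using f by (simp add: orthogonal_transformation_linear)
    have fm: "f \<in> borel_measurable borel"
      using linear_continuous_on[of f] lin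
      by (intro borel_measurable_continuous_onI) (simp add: linear_conv_bounded_linear)
    have fN: "f \<in> measurable N N"
      unfolding N_def using fm orthogonal_transformation_norm[OF f]
      by (intro measurable_restrict_space2 measurable_restrict_space1) (auto simp: space_restrict_space)
    have fU: "f \<in> measurable U U" using fm by (simp cong: measurable_cong_sets)
    have "AE x in U. x \<in> B"
      unfolding U_def using B0 by (intro AE_uniform_measureI) auto
    then have ae: "AE x in U. (f \<circ> g) x = (g \<circ> f) x"
    proof eventually_elim
      case (elim x)
      then have "x \<noteq> 0" "f x \<noteq> 0"
        using orthogonal_transformation_norm[OF f, of x] by (auto simp: B_def)
      then show ?case
        using orthogonal_transformation_norm[OF f, of x] lin by (simp add: g_def linear_scale)
    qed
    have "distr (distr U N g) (distr U N g) f = distr (distr U N g) N f"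
      by (rule distr_cong) auto
    also have "\<dots> = distr U N (f \<circ> g)" by (rule distr_distr[OF fN gN])
    also have "\<dots> = distr U N (g \<circ> f)"
      using ae measurable_comp[OF gN fN] measurable_comp[OF fU gN] by (intro distr_cong_AE) auto
    also have "\<dots> = distr (distr U U f) N g" by (rule distr_distr[OF gN fU, symmetric])
    also have "\<dots> = distr U N g" by (simp add: U_inv[OF f fm])
    finally show "distr (distr U N g) (distr U N g) f = distr U N g" .
  qed
  then show ?thesis by blast
qed

end

theory Submission
  imports Defs
begin

text \<open>
  Fix one functional \<open>l\<close> that vanishes on \<open>Sq_on d S\<close>, and consider the symmetric bilinear form
  \<open>b p q = l (p * q)\<close> on forms of degree \<open>d\<close>. A form \<open>q\<close> vanishing on \<open>S\<close> has its square in
  \<open>Sq_on d S\<close>, so \<open>b q q = 0\<close>: the quadratic form of \<open>b\<close> vanishes on the kernel of the evaluation at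
  \<open>S\<close>. Therefore \<open>b q q\<close> is a finite sum of products of two linear functionals of \<open>q\<close>: one is the
  value of \<open>q\<close> at a point of \<open>S\<close>, the other is bounded by the size of \<open>q\<close>. With the size
  measured by the inner product \<open>\<integral>pq d\<sigma>\<close>, this says
  \<open>\<bar>l (q\<^sup>2)\<bar> \<le> c * sqrt (M_S S (q\<^sup>2)) * sqrt (sphere_avg \<sigma> (q\<^sup>2))\<close>. The Cauchy--Schwarz
  inequality extends the estimate from single squares to sums of squares with the same constant
  (\<open>quadratic_form_vanishing_on_kernel_bound\<close>). Adding the estimates for \<open>l 1, \<dots>, l k\<close> gives the
  theorem.

  The size of \<open>q\<close> bounds every linear functional of \<open>q\<close> because the inner product is definite and
  the space of forms is finite-dimensional (\<open>positive_definite_on_Riesz\<close>). Definiteness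
  (\<open>sphere_avg_positive_definite\<close>) has an analytic part, that a rotation invariant
  probability measure charges every nonempty open subset of the sphere, and an algebraic part, that a form without nonzero
  values is the zero polynomial.
\<close>

section \<open>Bilinear forms on a finite-dimensional space\<close>

definition symmetric_bilinear_on :: "'a::real_vector set \<Rightarrow> ('a \<Rightarrow> 'a \<Rightarrow> real) \<Rightarrow> bool" where
  "symmetric_bilinear_on V b \<longleftrightarrow>
     (\<forall>u\<in>V. \<forall>v\<in>V. b u v = b v u) \<and> (\<forall>u\<in>V. linear_functional_on V (b u))"

definition positive_definite_on :: "'a::real_vector set \<Rightarrow> ('a \<Rightarrow> 'a \<Rightarrow> real) \<Rightarrow> bool" where
  "positive_definite_on V t \<longleftrightarrow> symmetric_bilinear_on V t \<and> (\<forall>u\<in>V. u \<noteq> 0 \<longrightarrow> t u u > 0)"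

lemma linear_functional_on_mono:
  "linear_functional_on V f \<Longrightarrow> W \<subseteq> V \<Longrightarrow> linear_functional_on W f"
  unfolding linear_functional_on_def by blast

lemma symmetric_bilinear_on_mono:
  "symmetric_bilinear_on V f \<Longrightarrow> W \<subseteq> V \<Longrightarrow> symmetric_bilinear_on W f"
  unfolding symmetric_bilinear_on_def using linear_functional_on_mono by (meson subsetD)

lemma positive_definite_on_mono:
  "positive_definite_on V f \<Longrightarrow> W \<subseteq> V \<Longrightarrow> positive_definite_on W f"
  unfolding positive_definite_on_def using symmetric_bilinear_on_mono by (meson subsetD)

lemma linear_functional_on_add:
  "linear_functional_on V f \<Longrightarrow> u \<in> V \<Longrightarrow> v \<in> V \<Longrightarrow> f (u + v) = f u + f v"
  by (auto simp: linear_functional_on_def)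

lemma linear_functional_on_scaleR:
  "linear_functional_on V f \<Longrightarrow> u \<in> V \<Longrightarrow> f (c *\<^sub>R u) = c * f u"
  by (auto simp: linear_functional_on_def)

lemma linear_functional_on_zero:
  "linear_functional_on V f \<Longrightarrow> subspace V \<Longrightarrow> f 0 = 0"
  using linear_functional_on_scaleR[of V f 0 0] by (auto simp: subspace_0)

lemma linear_functional_on_diff:
  "linear_functional_on V f \<Longrightarrow> subspace V \<Longrightarrow> u \<in> V \<Longrightarrow> v \<in> V \<Longrightarrow> f (u - v) = f u - f v"
  using linear_functional_on_add[of V f u "(-1) *\<^sub>R v"] linear_functional_on_scaleR[of V f v "-1"]
  by (auto simp: subspace_neg)

lemma linear_functional_on_sum:
  assumes "linear_functional_on V f" "subspace V" "\<And>i. i \<in> I \<Longrightarrow> g i \<in> V"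
  shows "f (\<Sum>i\<in>I. g i) = (\<Sum>i\<in>I. f (g i))"
  using assms(3)
proof (induction I rule: infinite_finite_induct)
  case (insert i I)
  then show ?case
    using assms(2) by (simp add: linear_functional_on_add[OF assms(1)] subspace_sum)
qed (simp_all add: linear_functional_on_zero[OF assms(1,2)])

lemma symmetric_bilinear_onD:
  assumes "symmetric_bilinear_on V b" "u \<in> V"
  shows "linear_functional_on V (b u)" "v \<in> V \<Longrightarrow> b u v = b v u"
  using assms by (auto simp: symmetric_bilinear_on_def)

lemma positive_definite_on_Cauchy_Schwarz:
  assumes t: "positive_definite_on V t" and V: "subspace V" and u: "u \<in> V" and v: "v \<in> V"
  shows "(t u v)\<^sup>2 \<le> t u u * t v v"
proof (cases "v = 0")
  case True
  have "linear_functional_on V (t w)" if "w \<in> V" for w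
    using t that by (auto simp: positive_definite_on_def symmetric_bilinear_on_def)
  then have "t u 0 = 0" "t 0 0 = 0"
    using u subspace_0[OF V] linear_functional_on_zero[OF _ V] by blast+
  then show ?thesis using True by simp
next
  case False
  have b: "symmetric_bilinear_on V t" and pos: "\<And>w. w \<in> V \<Longrightarrow> w \<noteq> 0 \<Longrightarrow> t w w > 0"
    using t by (auto simp: positive_definite_on_def)
  note lin = symmetric_bilinear_onD(1)[OF b] and sym = symmetric_bilinear_onD(2)[OF b]
  have z: "t 0 0 = 0"
    using lin[of 0] linear_functional_on_zero V subspace_0 by blast
  define a where "a = t u v / t v v"
  have vv: "t v v > 0" using pos[OF v False] .
  have w: "u - a *\<^sub>R v \<in> V" and av: "a *\<^sub>R v \<in> V"
    using V u v by (auto simp: subspace_diff subspace_scale)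
  have left: "t (u - a *\<^sub>R v) x = t u x - a * t v x" if x: "x \<in> V" for x
    using sym[OF w x] sym[OF u x] sym[OF v x] linear_functional_on_diff[OF lin[OF x] V u av]
      linear_functional_on_scaleR[OF lin[OF x] v] by simp
  have right: "t x (u - a *\<^sub>R v) = t x u - a * t x v" if x: "x \<in> V" for x
    using linear_functional_on_diff[OF lin[OF x] V u av]
      linear_functional_on_scaleR[OF lin[OF x] v] by simp
  have "t (u - a *\<^sub>R v) (u - a *\<^sub>R v) = t u u - 2 * a * t u v + a * a * t v v"
    unfolding left[OF w] right[OF u] right[OF v] using sym[OF u v] by (simp add: algebra_simps)
  moreover have "t (u - a *\<^sub>R v) (u - a *\<^sub>R v) \<ge> 0"
    using pos[OF w] z by (cases "u - a *\<^sub>R v = 0") (auto simp: less_imp_le)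
  moreover have "t u u - 2 * a * t u v + a * a * t v v = t u u - (t u v)\<^sup>2 / t v v"
    using vv by (simp add: a_def field_simps power2_eq_square)
  ultimately have "t u u - (t u v)\<^sup>2 / t v v \<ge> 0"
    by (simp only:)
  then show ?thesis using vv by (simp add: field_simps)
qed

text \<open>Gram--Schmidt step by step: when a vector \<open>v\<close> is added to the spanning set, the functional
  \<open>t v\<close> is already represented on the smaller span by some \<open>w\<close>, and \<open>v - w\<close> is orthogonal to that
  span, so that a representing vector is corrected by a multiple of \<open>v - w\<close>.\<close>

lemma positive_definite_on_Riesz:
  assumes "finite B" "positive_definite_on (span B) t" "linear_functional_on (span B) f"
  shows "\<exists>r\<in>span B. \<forall>q\<in>span B. f q = t r q"
  using assms
proof (induction B arbitrary: f)
  case empty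
  have "linear_functional_on {0} (t 0)"
    using empty by (auto simp: positive_definite_on_def symmetric_bilinear_on_def)
  then show ?case
    using empty linear_functional_on_zero[of "{0}" "t 0"] linear_functional_on_zero[of "{0}" f]
    by simp
next
  case (insert v B)
  let ?V = "span (insert v B)"
  have sub: "span B \<subseteq> ?V" by (rule span_mono) auto
  have b: "symmetric_bilinear_on ?V t" and pos: "\<And>w. w \<in> ?V \<Longrightarrow> w \<noteq> 0 \<Longrightarrow> t w w > 0"
    using insert.prems by (auto simp: positive_definite_on_def)
  note lin = symmetric_bilinear_onD(1)[OF b] and sym = symmetric_bilinear_onD(2)[OF b]
  note IH = insert.IH[OF positive_definite_on_mono[OF insert.prems(1) sub]]
  have v: "v \<in> ?V" by (simp add: span_base)
  obtain w where w: "w \<in> span B" and tw: "\<And>y. y \<in> span B \<Longrightarrow> t v y = t w y"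
    using IH[of "t v"] lin[OF v] linear_functional_on_mono sub by blast
  obtain r0 where r0: "r0 \<in> span B" and fr0: "\<And>y. y \<in> span B \<Longrightarrow> f y = t r0 y"
    using IH[of f] insert.prems(2) linear_functional_on_mono sub by blast
  define u where "u = v - w"
  have uV: "u \<in> ?V" unfolding u_def using v w sub by (auto intro: span_diff)
  have orth: "t y u = 0" if y: "y \<in> span B" for y
    unfolding u_def using linear_functional_on_diff[OF lin subspace_span v, of y w] y w sub tw[OF y]
      sym[of y v] sym[of y w] v by auto
  define c where "c = f u / t u u"
  have cu: "c *\<^sub>R u \<in> ?V" using uV by (simp add: span_scale)
  have r0V: "r0 \<in> ?V" and rV: "r0 + c *\<^sub>R u \<in> ?V"
    using r0 sub cu by (auto intro: span_add)
  \<comment> \<open>If \<open>u = 0\<close>, then \<open>c = 0\<close> by division by zero, which is consistent with \<open>f u = 0\<close>.\<close>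
  have cuu: "c * t u u = f u"
  proof (cases "u = 0")
    case True
    then have "f u = 0"
      using linear_functional_on_zero[OF insert.prems(2)] by simp
    then show ?thesis by (simp add: c_def)
  next
    case False
    then show ?thesis using pos[OF uV] by (simp add: c_def)
  qed
  show ?case
  proof (intro bexI ballI)
    show "r0 + c *\<^sub>R u \<in> ?V" by (rule rV)
    fix q assume q: "q \<in> ?V"
    then obtain k where k: "q - k *\<^sub>R v \<in> span B" by (auto simp: span_breakdown_eq)
    define y where "y = (q - k *\<^sub>R v) + k *\<^sub>R w"
    have y: "y \<in> span B" unfolding y_def using k w by (simp add: span_add span_scale)
    have qy: "q = y + k *\<^sub>R u" by (simp add: y_def u_def algebra_simps)
    have yV: "y \<in> ?V" and ku: "k *\<^sub>R u \<in> ?V" using y sub uV by (auto simp: span_scale)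
    have "t q (r0 + c *\<^sub>R u) = t q r0 + c * t q u"
      using linear_functional_on_add[OF lin[OF q] r0V cu] linear_functional_on_scaleR[OF lin[OF q] uV]
      by simp
    moreover have "t r0 q = t r0 y"
      unfolding qy using linear_functional_on_add[OF lin[OF r0V] yV ku]
        linear_functional_on_scaleR[OF lin[OF r0V] uV] orth[OF r0] by simp
    moreover have "t u q = k * t u u"
      unfolding qy using linear_functional_on_add[OF lin[OF uV] yV ku]
        linear_functional_on_scaleR[OF lin[OF uV] uV] orth[OF y] sym[OF yV uV] by simp
    moreover have "f q = f y + k * f u"
      unfolding qy using linear_functional_on_add[OF insert.prems(2) yV ku]
        linear_functional_on_scaleR[OF insert.prems(2) uV] by simp
    ultimately show "f q = t (r0 + c *\<^sub>R u) q"
      using sym[OF q r0V] sym[OF q uV] sym[OF q rV] fr0[OF y] cuu by (simp add: algebra_simps)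
  qed
qed

text \<open>The vectors \<open>r s\<close> describe a linear right inverse, on its range, of the map
  \<open>q \<mapsto> (ev s q)\<^sub>s\<close>; subtracting it projects onto the common kernel of the functionals. They are
  found one functional at a time: a new functional that does not vanish on the kernel reached so
  far has value \<open>1\<close> at some \<open>e\<close> in that kernel, and \<open>e\<close> corrects the old vectors.\<close>

lemma projection_onto_common_kernel:
  assumes "finite S" "subspace V" "\<And>s. s \<in> S \<Longrightarrow> linear_functional_on V (ev s)"
  shows "\<exists>r. (\<forall>s\<in>S. r s \<in> V) \<and> (\<forall>q\<in>V. \<forall>s\<in>S. ev s (q - (\<Sum>x\<in>S. ev x q *\<^sub>R r x)) = 0)"
  using assms(1,3)
proof (induction S)
  case empty
  then show ?case by simp
next
  case (insert z S)
  then obtain r where r: "\<And>s. s \<in> S \<Longrightarrow> r s \<in> V"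
    and ker: "\<And>q s. q \<in> V \<Longrightarrow> s \<in> S \<Longrightarrow> ev s (q - (\<Sum>x\<in>S. ev x q *\<^sub>R r x)) = 0"
    by (metis insertCI)
  note V = assms(2) and ev = insert.prems
  let ?p = "\<lambda>q. q - (\<Sum>x\<in>S. ev x q *\<^sub>R r x)"
  have pV: "?p q \<in> V" if "q \<in> V" for q
    using V r that by (intro subspace_diff subspace_sum subspace_scale) auto
  show ?case
  proof (cases "\<forall>q\<in>V. (\<forall>s\<in>S. ev s q = 0) \<longrightarrow> ev z q = 0")
    case True
    have "(\<Sum>x\<in>insert z S. ev x q *\<^sub>R (r(z := 0)) x) = (\<Sum>x\<in>S. ev x q *\<^sub>R r x)" for q
      using insert.hyps by (simp, intro sum.cong) auto
    moreover have "ev s (?p q) = 0" if "q \<in> V" "s \<in> insert z S" for q s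
      using True ker pV that by auto
    ultimately show ?thesis
      using r V by (intro exI[of _ "r(z := 0)"]) (auto simp: subspace_0)
  next
    case False
    then obtain e0 where e0: "e0 \<in> V" "\<And>s. s \<in> S \<Longrightarrow> ev s e0 = 0" "ev z e0 \<noteq> 0" by blast
    define e where "e = (1 / ev z e0) *\<^sub>R e0"
    have e: "e \<in> V" "\<And>s. s \<in> S \<Longrightarrow> ev s e = 0" "ev z e = 1"
      using e0 V linear_functional_on_scaleR[OF ev _, of _ e0] by (auto simp: e_def subspace_scale)
    define r' where "r' x = (if x = z then e else r x - ev z (r x) *\<^sub>R e)" for x
    have r': "r' x \<in> V" if "x \<in> insert z S" for x
      using that r e V by (auto simp: r'_def subspace_diff subspace_scale)
    have "ev s (q - (\<Sum>x\<in>insert z S. ev x q *\<^sub>R r' x)) = 0" if q: "q \<in> V" and s: "s \<in> insert z S" for q s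
    proof -
      have "ev z (?p q) = ev z q - (\<Sum>x\<in>S. ev x q * ev z (r x))"
        using V r q ev
        by (subst linear_functional_on_diff[of V], simp, simp, simp, intro subspace_sum subspace_scale, simp_all)
           (subst linear_functional_on_sum[of V], auto simp: subspace_scale linear_functional_on_scaleR[of V] intro!: sum.cong)
      moreover have "(\<Sum>x\<in>insert z S. ev x q *\<^sub>R r' x)
          = ev z q *\<^sub>R e + ((\<Sum>x\<in>S. ev x q *\<^sub>R r x) - (\<Sum>x\<in>S. ev x q * ev z (r x)) *\<^sub>R e)"
      proof -
        have "(\<Sum>x\<in>S. ev x q *\<^sub>R r' x) = (\<Sum>x\<in>S. ev x q *\<^sub>R r x - (ev x q * ev z (r x)) *\<^sub>R e)"
          using insert.hyps by (intro sum.cong) (auto simp: r'_def scaleR_diff_right)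
        then show ?thesis using insert.hyps by (simp add: sum_subtractf scaleR_left.sum r'_def)
      qed
      ultimately have eq: "q - (\<Sum>x\<in>insert z S. ev x q *\<^sub>R r' x) = ?p q - ev z (?p q) *\<^sub>R e"
        by (simp only:) (simp add: algebra_simps)
      have "ev s (?p q - ev z (?p q) *\<^sub>R e) = ev s (?p q) - ev z (?p q) * ev s e"
        using linear_functional_on_diff[OF ev[OF s] V pV[OF q], of "ev z (?p q) *\<^sub>R e"]
          linear_functional_on_scaleR[OF ev[OF s] e(1)] V e(1) by (simp add: subspace_scale)
      then show ?thesis
        unfolding eq using s e ker[OF q] by auto
    qed
    then show ?thesis using r' by (intro exI[of _ r']) blast
  qed
qed

text \<open>Polarisation makes \<open>b\<close> vanish on pairs from the common kernel \<open>K\<close> of the functionals. Let \<open>a\<close> be the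
  projection of \<open>q\<close> to \<open>K\<close>. Then \<open>b q q = b q q - b a a = b (q - a) (q + a)\<close>, and \<open>q - a\<close> is a
  combination of fixed vectors with coefficients \<open>ev s q\<close>. So \<open>b q q = (\<Sum>s. ev s q * F s q)\<close>
  with linear functionals \<open>F s\<close>, and each \<open>(F s q)\<^sup>2\<close> is at most a constant times \<open>t q q\<close>. Since
  this expression is a sum of products, the Cauchy--Schwarz inequality bounds sums over many \<open>q\<close>
  with a constant that does not depend on their number.\<close>

lemma quadratic_form_vanishing_on_kernel_bound:
  assumes S: "finite S" and B: "finite B"
    and ev: "\<And>s. s \<in> S \<Longrightarrow> linear_functional_on (span B) (ev s)"
    and t: "positive_definite_on (span B) t"
    and b: "symmetric_bilinear_on (span B) b"
    and van: "\<And>q. q \<in> span B \<Longrightarrow> (\<And>s. s \<in> S \<Longrightarrow> ev s q = 0) \<Longrightarrow> b q q = 0"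
  shows "\<exists>C\<ge>0. \<forall>J q. (\<forall>j\<in>J. q j \<in> span B) \<longrightarrow>
           (\<Sum>j\<in>J. b (q j) (q j))\<^sup>2 \<le> C * (\<Sum>j\<in>J. \<Sum>s\<in>S. (ev s (q j))\<^sup>2) * (\<Sum>j\<in>J. t (q j) (q j))"
proof -
  let ?V = "span B"
  have V: "subspace ?V" by simp
  note lin = symmetric_bilinear_onD(1)[OF b] and sym = symmetric_bilinear_onD(2)[OF b]
  obtain r where r: "\<And>s. s \<in> S \<Longrightarrow> r s \<in> ?V"
    and ker: "\<And>q s. q \<in> ?V \<Longrightarrow> s \<in> S \<Longrightarrow> ev s (q - (\<Sum>x\<in>S. ev x q *\<^sub>R r x)) = 0"
    using projection_onto_common_kernel[where ev = ev, OF S V ev] by blast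
  define z where "z q = (\<Sum>x\<in>S. ev x q *\<^sub>R r x)" for q
  have z: "z q \<in> ?V" for q
    unfolding z_def using r by (intro span_sum span_scale)
  have z_add: "z (p + q) = z p + z q" if "p \<in> ?V" "q \<in> ?V" for p q
    unfolding z_def sum.distrib[symmetric]
    using that linear_functional_on_add[OF ev] by (intro sum.cong) (auto simp: scaleR_left_distrib)
  have z_scale: "z (c *\<^sub>R q) = c *\<^sub>R z q" if "q \<in> ?V" for c q
    unfolding z_def scaleR_sum_right
    using that linear_functional_on_scaleR[OF ev] by (intro sum.cong) auto
  define F where "F s q = b (r s) (q + (q - z q))" for s q
  have memb: "q + (q - z q) \<in> ?V" if "q \<in> ?V" for q
    using that z by (intro span_add span_diff)
  have F: "linear_functional_on ?V (F s)" if s: "s \<in> S" for s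
    unfolding linear_functional_on_def
  proof (intro conjI ballI allI)
    fix u v assume u: "u \<in> ?V" and v: "v \<in> ?V"
    have "(u + v) + ((u + v) - z (u + v)) = (u + (u - z u)) + (v + (v - z v))"
      using z_add[OF u v] by simp
    then show "F s (u + v) = F s u + F s v"
      unfolding F_def using linear_functional_on_add[OF lin[OF r[OF s]] memb[OF u] memb[OF v]] by (simp only:)
  next
    fix c u assume u: "u \<in> ?V"
    have "c *\<^sub>R u + (c *\<^sub>R u - z (c *\<^sub>R u)) = c *\<^sub>R (u + (u - z u))"
      using z_scale[OF u] by (simp add: algebra_simps)
    then show "F s (c *\<^sub>R u) = c * F s u"
      unfolding F_def using linear_functional_on_scaleR[OF lin[OF r[OF s]] memb[OF u]] by simp
  qed
  have bq: "b q q = (\<Sum>s\<in>S. ev s q * F s q)" if q: "q \<in> ?V" for q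
  proof -
    have a: "q - z q \<in> ?V" using q z by (simp add: span_diff)
    have "b (q - z q) (q - z q) = 0"
      using van[OF a] ker[OF q] by (simp add: z_def)
    moreover have "b (q - z q) (q - z q) = b (q - z q) q - b (q - z q) (z q)"
      using linear_functional_on_diff[OF lin[OF a] V q z] .
    moreover have "b q (q - z q) = b q q - b q (z q)"
      using linear_functional_on_diff[OF lin[OF q] V q z] .
    ultimately have "b q q = b (z q) q + b (z q) (q - z q)"
      using sym[OF a q] sym[OF a z] sym[OF q z] by simp
    also have "\<dots> = b (q + (q - z q)) (z q)"
      using linear_functional_on_add[OF lin[OF z] q a] sym[OF z memb[OF q]] by simp
    \<comment> \<open>Only the second argument of \<open>b\<close> is to be expanded, not the \<open>z q\<close> in the first.\<close>
    also have "\<dots> = (\<Sum>s\<in>S. b (q + (q - z q)) (ev s q *\<^sub>R r s))"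
      unfolding z_def[of q, THEN arg_cong[of _ _ "b _"]]
      using r by (intro linear_functional_on_sum[OF lin[OF memb[OF q]] V] span_scale)
    also have "\<dots> = (\<Sum>s\<in>S. ev s q * F s q)"
      using linear_functional_on_scaleR[OF lin[OF memb[OF q]] r] sym[OF memb[OF q] r]
      by (intro sum.cong) (auto simp: F_def)
    finally show ?thesis .
  qed
  have "\<exists>w\<in>?V. \<forall>q\<in>?V. F s q = t w q" if "s \<in> S" for s
    by (rule positive_definite_on_Riesz[OF B t F[OF that]])
  then obtain \<rho> where \<rho>: "\<And>s. s \<in> S \<Longrightarrow> \<rho> s \<in> ?V"
    and F\<rho>: "\<And>s q. s \<in> S \<Longrightarrow> q \<in> ?V \<Longrightarrow> F s q = t (\<rho> s) q"
    by metis
  define C where "C = (\<Sum>s\<in>S. t (\<rho> s) (\<rho> s))"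
  have "symmetric_bilinear_on ?V t" using t by (simp add: positive_definite_on_def)
  then have "t 0 0 = 0"
    using linear_functional_on_zero[OF symmetric_bilinear_onD(1) V] by (simp add: span_zero)
  then have tpos: "t w w \<ge> 0" if "w \<in> ?V" for w
    using t that by (cases "w = 0") (auto simp: positive_definite_on_def less_imp_le)
  have "C \<ge> 0" unfolding C_def using tpos \<rho> by (intro sum_nonneg) auto
  moreover have "(\<Sum>j\<in>J. b (q j) (q j))\<^sup>2 \<le> C * (\<Sum>j\<in>J. \<Sum>s\<in>S. (ev s (q j))\<^sup>2) * (\<Sum>j\<in>J. t (q j) (q j))"
    if q: "\<forall>j\<in>J. q j \<in> ?V" for J :: "'d set" and q
  proof -
    have "(\<Sum>s\<in>S. (F s (q j))\<^sup>2) \<le> C * t (q j) (q j)" if "j \<in> J" for j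
      unfolding C_def sum_distrib_right
      using that q positive_definite_on_Cauchy_Schwarz[OF t V] \<rho> F\<rho> by (intro sum_mono) auto
    then have F_le: "(\<Sum>j\<in>J. \<Sum>s\<in>S. (F s (q j))\<^sup>2) \<le> C * (\<Sum>j\<in>J. t (q j) (q j))"
      unfolding sum_distrib_left by (intro sum_mono)
    have "(\<Sum>j\<in>J. b (q j) (q j)) = (\<Sum>(j, s)\<in>J \<times> S. ev s (q j) * F s (q j))"
      unfolding sum.cartesian_product[symmetric] using q bq by (intro sum.cong) auto
    then have "(\<Sum>j\<in>J. b (q j) (q j))\<^sup>2 = (\<Sum>x\<in>J \<times> S. ev (snd x) (q (fst x)) * F (snd x) (q (fst x)))\<^sup>2"
      by (simp add: case_prod_unfold)
    also have "\<dots> \<le> (\<Sum>x\<in>J \<times> S. (ev (snd x) (q (fst x)))\<^sup>2) * (\<Sum>x\<in>J \<times> S. (F (snd x) (q (fst x)))\<^sup>2)"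
      by (rule Cauchy_Schwarz_ineq_sum)
    also have "\<dots> = (\<Sum>j\<in>J. \<Sum>s\<in>S. (ev s (q j))\<^sup>2) * (\<Sum>j\<in>J. \<Sum>s\<in>S. (F s (q j))\<^sup>2)"
      by (simp add: sum.cartesian_product case_prod_unfold)
    also have "\<dots> \<le> (\<Sum>j\<in>J. \<Sum>s\<in>S. (ev s (q j))\<^sup>2) * (C * (\<Sum>j\<in>J. t (q j) (q j)))"
      by (intro mult_left_mono F_le sum_nonneg) auto
    finally show ?thesis by (simp add: mult_ac)
  qed
  ultimately show ?thesis by blast
qed

section \<open>Polynomials and their values\<close>

definition monomial_value :: "real ^ 'n::finite \<Rightarrow> ('n \<Rightarrow>\<^sub>0 nat) \<Rightarrow> real" where
  "monomial_value x e = (\<Prod>i\<in>UNIV. (x $ i) ^ Poly_Mapping.lookup e i)"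

lemma monomial_value_add: "monomial_value x (e + f) = monomial_value x e * monomial_value x f"
  by (simp add: monomial_value_def lookup_add power_add prod.distrib)

lemma peval_superset:
  assumes "finite A" "Poly_Mapping.keys p \<subseteq> A"
  shows "peval p x = (\<Sum>e\<in>A. Poly_Mapping.lookup p e * monomial_value x e)"
  unfolding peval_def monomial_value_def
  using assms by (intro sum.mono_neutral_left) (auto simp: in_keys_iff)

lemma peval_add: "peval (p + q) x = peval p x + peval q x"
proof -
  let ?A = "Poly_Mapping.keys p \<union> Poly_Mapping.keys q"
  have "Poly_Mapping.keys (p + q) \<subseteq> ?A" by (rule Poly_Mapping.keys_add)
  then show ?thesis
    by (simp add: peval_superset[of ?A] lookup_add distrib_right sum.distrib)
qed

lemma lookup_scaleR: "Poly_Mapping.lookup (c *\<^sub>R p) e = c *\<^sub>R Poly_Mapping.lookup p e"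
  by transfer simp

lemma peval_scaleR: "peval (c *\<^sub>R p) x = c * peval p x"
proof -
  have "Poly_Mapping.keys (c *\<^sub>R p) \<subseteq> Poly_Mapping.keys p"
    by (auto simp: in_keys_iff lookup_scaleR)
  then show ?thesis
    by (simp add: peval_superset[of "Poly_Mapping.keys p"] lookup_scaleR sum_distrib_left mult.assoc)
qed

lemma peval_zero [simp]: "peval 0 x = 0"
  by (simp add: peval_def)

lemma peval_sum: "peval (\<Sum>i\<in>I. p i) x = (\<Sum>i\<in>I. peval (p i) x)"
  by (induction I rule: infinite_finite_induct) (auto simp: peval_add)

lemma peval_single: "peval (Poly_Mapping.single e c) x = c * monomial_value x e"
  by (subst peval_superset[of "{e}"]) auto

lemma sum_of_monomials:
  fixes p :: "'a \<Rightarrow>\<^sub>0 'b::comm_monoid_add"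
  shows "p = (\<Sum>e\<in>Poly_Mapping.keys p. Poly_Mapping.single e (Poly_Mapping.lookup p e))"
  by (rule poly_mapping_eqI) (auto simp: lookup_sum lookup_single when_def in_keys_iff)

lemma peval_mult: "peval (p * q) x = peval p x * peval q x"
proof -
  have "peval (p * q) x =
      peval ((\<Sum>e\<in>Poly_Mapping.keys p. Poly_Mapping.single e (Poly_Mapping.lookup p e)) *
             (\<Sum>e\<in>Poly_Mapping.keys q. Poly_Mapping.single e (Poly_Mapping.lookup q e))) x"
    by (simp add: sum_of_monomials[symmetric])
  also have "\<dots> = (\<Sum>e\<in>Poly_Mapping.keys p. \<Sum>f\<in>Poly_Mapping.keys q.
      (Poly_Mapping.lookup p e * monomial_value x e) * (Poly_Mapping.lookup q f * monomial_value x f))"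
    by (simp add: sum_product peval_sum mult_single peval_single monomial_value_add mult_ac)
  also have "\<dots> = peval p x * peval q x"
    by (simp add: sum_product peval_def monomial_value_def)
  finally show ?thesis .
qed

lemma scaleR_times_poly:
  fixes p q :: "'n::finite rpoly"
  shows "p * (c *\<^sub>R q) = c *\<^sub>R (p * q)"
proof -
  have eq: "c *\<^sub>R r = Poly_Mapping.single 0 c * r" for r :: "'n rpoly"
  proof (rule poly_mapping_eqI)
    fix e
    show "Poly_Mapping.lookup (c *\<^sub>R r) e = Poly_Mapping.lookup (Poly_Mapping.single 0 c * r) e"
      by (simp add: lookup_scaleR mult_map_scale_conv_mult[symmetric] Poly_Mapping.map.rep_eq when_def)
  qed
  show ?thesis unfolding eq by (rule mult.left_commute)
qed

text \<open>Distinct monomials are linearly independent as functions of the variables in \<open>A\<close>: collecting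
  the terms by the exponent of one variable gives a polynomial in that variable whose coefficients
  are combinations of monomials in the others.\<close>

lemma monomial_functions_independent:
  fixes c :: "'e \<Rightarrow> real" and g :: "'e \<Rightarrow> 'i \<Rightarrow> nat"
  assumes "finite A" "finite E"
    and "\<And>e f. e \<in> E \<Longrightarrow> f \<in> E \<Longrightarrow> (\<And>i. i \<in> A \<Longrightarrow> g e i = g f i) \<Longrightarrow> e = f"
    and "\<And>x. (\<Sum>e\<in>E. c e * (\<Prod>i\<in>A. x i ^ g e i)) = 0"
    and "e \<in> E"
  shows "c e = 0"
  using assms
proof (induction A arbitrary: E rule: finite_induct)
  case empty
  then have "E = {e}" by auto
  then show ?case using empty.prems(3)[of "\<lambda>_. 0"] by simp
next
  case (insert a A)
  define N where "N = Max ((\<lambda>e. g e a) ` E)"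
  have N: "g e a \<le> N" if "e \<in> E" for e
    using that insert.prems(1) by (auto simp: N_def)
  define h where "h x k = (\<Sum>e | e \<in> E \<and> g e a = k. c e * (\<Prod>i\<in>A. x i ^ g e i))" for x :: "'i \<Rightarrow> real" and k
  have "h x k = 0" if "k \<le> N" for x k
  proof -
    have "(\<Sum>k\<le>N. h x k * y ^ k) = 0" for y
    proof -
      have other: "(\<Prod>i\<in>A. (x(a := y)) i ^ g e i) = (\<Prod>i\<in>A. x i ^ g e i)" for e
        using insert.hyps by (intro prod.cong) auto
      have "0 = (\<Sum>e\<in>E. c e * (\<Prod>i\<in>insert a A. (x(a := y)) i ^ g e i))"
        using insert.prems(3)[of "x(a := y)"] by simp
      also have "\<dots> = (\<Sum>e\<in>E. c e * (\<Prod>i\<in>A. x i ^ g e i) * y ^ g e a)"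
        unfolding prod.insert[OF insert.hyps] other by (simp add: mult_ac)
      also have "\<dots> = (\<Sum>k\<le>N. \<Sum>e | e \<in> E \<and> g e a = k. c e * (\<Prod>i\<in>A. x i ^ g e i) * y ^ g e a)"
        using insert.prems(1) N by (intro sum.group[symmetric]) auto
      also have "\<dots> = (\<Sum>k\<le>N. h x k * y ^ k)"
        by (simp add: h_def sum_distrib_right)
      finally show ?thesis by simp
    qed
    then show ?thesis using that polyfun_eq_0[of "h x" N] by simp
  qed
  then have zero: "(\<Sum>f | f \<in> E \<and> g f a = g e a. c f * (\<Prod>i\<in>A. x i ^ g f i)) = 0" for x
    using N[OF insert.prems(4)] by (simp add: h_def)
  show ?case
  proof (rule insert.IH[of "{f \<in> E. g f a = g e a}"])
    fix f f' assume "f \<in> {f \<in> E. g f a = g e a}" "f' \<in> {f \<in> E. g f a = g e a}"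
      and "\<And>i. i \<in> A \<Longrightarrow> g f i = g f' i"
    then show "f = f'" by (intro insert.prems(2)) auto
  qed (use insert.prems zero in auto)
qed

lemma polynomial_eq_zero_if_values_zero:
  assumes "\<And>x. peval p x = 0"
  shows "p = 0"
proof (rule poly_mapping_eqI)
  fix e
  have "(\<Sum>e\<in>Poly_Mapping.keys p. Poly_Mapping.lookup p e * (\<Prod>i\<in>UNIV. x i ^ Poly_Mapping.lookup e i)) = 0"
    for x :: "'a \<Rightarrow> real"
    using assms[of "\<chi> i. x i"] by (simp add: peval_def)
  then have "Poly_Mapping.lookup p e = 0" if "e \<in> Poly_Mapping.keys p"
    using that by (intro monomial_functions_independent[where A = UNIV and E = "Poly_Mapping.keys p"
          and g = Poly_Mapping.lookup and c = "Poly_Mapping.lookup p"])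
      (simp_all add: poly_mapping_eqI)
  then show "Poly_Mapping.lookup p e = Poly_Mapping.lookup 0 e"
    by (cases "e \<in> Poly_Mapping.keys p") (auto simp: in_keys_iff)
qed

section \<open>Forms\<close>

lemma forms_mult: "p \<in> forms m \<Longrightarrow> q \<in> forms k \<Longrightarrow> p * q \<in> forms (m + k)"
  using keys_mult[of p q] by (fastforce simp: forms_def lookup_add sum.distrib)

lemma subspace_forms: "subspace (forms m)"
proof (rule subspaceI)
  fix p q :: "'a rpoly" and c :: real
  show "(0 :: 'a rpoly) \<in> forms m" by (simp add: forms_def)
  show "p + q \<in> forms m" if "p \<in> forms m" "q \<in> forms m"
    using Poly_Mapping.keys_add[of p q] that by (auto simp: forms_def)
  show "c *\<^sub>R p \<in> forms m" if "p \<in> forms m"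
    using that by (auto simp: forms_def in_keys_iff lookup_scaleR)
qed

lemma forms_finitely_spanned: "\<exists>B. finite B \<and> forms m = span B"
proof -
  define E :: "('a \<Rightarrow>\<^sub>0 nat) set" where "E = {e. (\<Sum>i\<in>UNIV. Poly_Mapping.lookup e i) = m}"
  have "Poly_Mapping.lookup e i \<le> m" if "e \<in> E" for e i
    using that member_le_sum[of i UNIV "Poly_Mapping.lookup e"] by (simp add: E_def)
  then have "Poly_Mapping.lookup ` E \<subseteq> Pi\<^sub>E UNIV (\<lambda>_. {..m})"
    by (auto simp: PiE_iff)
  then have "finite (Poly_Mapping.lookup ` E)"
    by (rule finite_subset) (auto intro: finite_PiE)
  then have E: "finite E"
    by (rule finite_imageD) (auto intro!: inj_onI poly_mapping_eqI)
  define B where "B = (\<lambda>e. Poly_Mapping.single e (1::real)) ` E"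
  have "p \<in> span B" if p: "p \<in> forms m" for p
  proof -
    have "Poly_Mapping.lookup p e *\<^sub>R Poly_Mapping.single e (1::real)
        = Poly_Mapping.single e (Poly_Mapping.lookup p e)" for e
      by (rule poly_mapping_eqI) (simp add: lookup_scaleR lookup_single when_def)
    then have "p = (\<Sum>e\<in>Poly_Mapping.keys p. Poly_Mapping.lookup p e *\<^sub>R Poly_Mapping.single e 1)"
      by (simp add: sum_of_monomials[symmetric])
    also have "\<dots> \<in> span B"
      using p by (intro span_sum span_scale span_base) (auto simp: B_def E_def forms_def)
    finally show ?thesis .
  qed
  moreover have "span B \<subseteq> forms m"
    by (rule span_minimal[OF _ subspace_forms]) (auto simp: B_def E_def forms_def)
  ultimately show ?thesis using E by (auto simp: B_def)
qed

lemma peval_form_scaleR: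
  assumes "p \<in> forms m"
  shows "peval p (c *\<^sub>R x) = c ^ m * peval p x"
proof -
  have "monomial_value (c *\<^sub>R x) e = c ^ m * monomial_value x e" if "e \<in> Poly_Mapping.keys p" for e
  proof -
    have "monomial_value (c *\<^sub>R x) e = (\<Prod>i\<in>UNIV. c ^ Poly_Mapping.lookup e i) * monomial_value x e"
      by (simp add: monomial_value_def power_mult_distrib prod.distrib)
    also have "(\<Prod>i\<in>UNIV. c ^ Poly_Mapping.lookup e i) = c ^ m"
      using assms that by (simp add: power_sum[symmetric] forms_def)
    finally show ?thesis .
  qed
  then show ?thesis
    unfolding peval_def monomial_value_def[symmetric] sum_distrib_left
    by (intro sum.cong) auto
qed

lemma form_eq_zero_if_zero_on_sphere:
  assumes p: "p \<in> forms m" and z: "\<And>x. x \<in> sphere 0 1 \<Longrightarrow> peval p x = 0"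
  shows "p = 0"
proof (rule polynomial_eq_zero_if_values_zero)
  fix x :: "real ^ 'a"
  \<comment> \<open>The origin is not a multiple of a unit vector \<open>sgn x\<close>, so there any unit vector is used.\<close>
  obtain u where u: "u \<in> sphere 0 1" "x = norm x *\<^sub>R u"
  proof (cases "x = 0")
    case True
    then show ?thesis using that[of "axis undefined 1"] by simp
  next
    case False
    then show ?thesis using that[of "sgn x"] by (simp add: norm_sgn sgn_div_norm)
  qed
  then show "peval p x = 0"
    using peval_form_scaleR[OF p, of "norm x" u] z[OF u(1)] by simp
qed

section \<open>The uniform measure on the sphere\<close>

lemma continuous_on_peval: "continuous_on A (peval p)"
  unfolding peval_def by (intro continuous_intros)

lemma space_uniform_sphere_measure:
  "uniform_sphere_measure \<sigma> \<Longrightarrow> space \<sigma> = sphere 0 1"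
  unfolding uniform_sphere_measure_def
  using sets_eq_imp_space_eq[of \<sigma> "restrict_space borel (sphere 0 1)"]
  by (simp add: space_restrict_space)

lemma borel_measurable_uniform_sphere_measure:
  assumes "uniform_sphere_measure \<sigma>" "f \<in> borel_measurable borel"
  shows "f \<in> borel_measurable \<sigma>"
proof -
  have "sets \<sigma> = sets (restrict_space borel (sphere 0 1))"
    using assms by (simp add: uniform_sphere_measure_def)
  then show ?thesis
    using measurable_restrict_space1[OF assms(2)] measurable_cong_sets by blast
qed

lemma integrable_peval:
  assumes \<sigma>: "uniform_sphere_measure \<sigma>"
  shows "integrable \<sigma> (peval p)"
proof -
  interpret prob_space \<sigma> using \<sigma> by (simp add: uniform_sphere_measure_def)
  have "bounded (peval p ` sphere 0 1)"
    by (intro compact_imp_bounded compact_continuous_image continuous_on_peval compact_sphere)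
  then obtain K where "\<And>x. x \<in> sphere 0 1 \<Longrightarrow> norm (peval p x) \<le> K"
    unfolding bounded_iff by blast
  then have "AE x in \<sigma>. norm (peval p x) \<le> K"
    using space_uniform_sphere_measure[OF \<sigma>] by (intro AE_I2) auto
  moreover have "peval p \<in> borel_measurable \<sigma>"
    by (intro borel_measurable_uniform_sphere_measure[OF \<sigma>] borel_measurable_continuous_onI
        continuous_on_peval)
  ultimately show ?thesis by (rule integrable_const_bound)
qed

text \<open>Rotations carry a null neighbourhood of one point to null neighbourhoods of all points, and
  finitely many of these cover the compact sphere, which has measure \<open>1\<close>.\<close>

lemma uniform_sphere_measure_full_support:
  fixes \<sigma> :: "(real ^ 'n::finite) measure"
  assumes \<sigma>: "uniform_sphere_measure \<sigma>" and U: "open U" and x0: "x0 \<in> U" "x0 \<in> sphere 0 1"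
  shows "emeasure \<sigma> (U \<inter> sphere 0 1) \<noteq> 0"
proof
  assume null: "emeasure \<sigma> (U \<inter> sphere 0 1) = 0"
  interpret prob_space \<sigma> using \<sigma> by (simp add: uniform_sphere_measure_def)
  have sets: "sets \<sigma> = sets (restrict_space borel (sphere 0 1))"
    and inv: "\<And>f. orthogonal_transformation f \<Longrightarrow> distr \<sigma> \<sigma> f = \<sigma>"
    using \<sigma> by (auto simp: uniform_sphere_measure_def)
  note space = space_uniform_sphere_measure[OF \<sigma>]
  have open_sets: "W \<inter> sphere 0 1 \<in> sets \<sigma>" if "open W" for W
    unfolding sets using that by (auto simp: sets_restrict_space)
  have "\<exists>f :: real ^ 'n \<Rightarrow> real ^ 'n. orthogonal_transformation f \<and> f y = x0" if "y \<in> sphere 0 1" for y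
    using that x0 orthogonal_transformation_exists[of y x0] by (metis mem_sphere_0)
  then obtain f :: "real ^ 'n \<Rightarrow> real ^ 'n \<Rightarrow> real ^ 'n"
    where f: "\<And>y. y \<in> sphere 0 1 \<Longrightarrow> orthogonal_transformation (f y)"
      and fx0: "\<And>y. y \<in> sphere 0 1 \<Longrightarrow> f y y = x0"
    by metis
  have cont: "continuous_on UNIV (f y)" if "y \<in> sphere 0 1" for y
    using f[OF that] by (simp add: linear_continuous_on orthogonal_transformation_linear
        linear_linear linear_conv_bounded_linear[symmetric])
  have op: "open (f y -` U)" if "y \<in> sphere 0 1" for y
    using cont[OF that] U by (simp add: open_vimage)
  have null_f: "f y -` U \<inter> sphere 0 1 \<in> null_sets \<sigma>" if y: "y \<in> sphere 0 1" for y
  proof -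
    have "f y \<in> borel_measurable borel"
      by (rule borel_measurable_continuous_onI[OF cont[OF y]])
    then have "f y \<in> measurable (restrict_space borel (sphere 0 1)) (restrict_space borel (sphere 0 1))"
      using orthogonal_transformation_norm[OF f[OF y]]
      by (intro measurable_restrict_space2 measurable_restrict_space1) (auto simp: space_restrict_space)
    then have meas: "f y \<in> measurable \<sigma> \<sigma>"
      using measurable_cong_sets[OF sets sets] by blast
    have "emeasure \<sigma> (f y -` (U \<inter> sphere 0 1) \<inter> space \<sigma>) = emeasure (distr \<sigma> \<sigma> (f y)) (U \<inter> sphere 0 1)"
      using meas open_sets[OF U] by (simp add: emeasure_distr)
    also have "\<dots> = 0" using inv[OF f[OF y]] null by simp
    also have "f y -` (U \<inter> sphere 0 1) \<inter> space \<sigma> = f y -` U \<inter> sphere 0 1"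
      using orthogonal_transformation_norm[OF f[OF y]] by (auto simp: space)
    finally show ?thesis using open_sets[OF op[OF y]] by auto
  qed
  have cover: "sphere 0 1 \<subseteq> (\<Union>y\<in>sphere 0 1. f y -` U)" using fx0 x0 by auto
  obtain D where D: "D \<subseteq> sphere 0 1" "finite D" "sphere 0 1 \<subseteq> (\<Union>y\<in>D. f y -` U)"
    by (rule compactE_image[OF compact_sphere op cover])
  have "(\<Union>y\<in>D. f y -` U \<inter> sphere 0 1) \<in> null_sets \<sigma>"
    using D null_f by (intro null_sets.finite_UN) auto
  moreover have "(\<Union>y\<in>D. f y -` U \<inter> sphere 0 1) = space \<sigma>"
    using D by (auto simp: space)
  ultimately show False using emeasure_space_1 by auto
qed

text \<open>The pairing \<open>\<langle>p, q\<rangle> = \<integral>pq d\<sigma>\<close> is an inner product on forms: a form whose square has integral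
  zero vanishes on the sphere, since the set where it does not vanish is open and null.\<close>

lemma sphere_avg_positive_definite:
  assumes \<sigma>: "uniform_sphere_measure \<sigma>"
  shows "positive_definite_on (forms m) (\<lambda>p q. sphere_avg \<sigma> (p * q))"
  unfolding positive_definite_on_def symmetric_bilinear_on_def linear_functional_on_def
proof (intro conjI ballI allI impI)
  fix p q r :: "'a rpoly" and c :: real
  show "sphere_avg \<sigma> (p * q) = sphere_avg \<sigma> (q * p)" by (simp add: mult.commute)
  show "sphere_avg \<sigma> (p * (q + r)) = sphere_avg \<sigma> (p * q) + sphere_avg \<sigma> (p * r)"
    unfolding sphere_avg_def distrib_left peval_add
    by (rule Bochner_Integration.integral_add) (rule integrable_peval[OF \<sigma>])+
  show "sphere_avg \<sigma> (p * (c *\<^sub>R q)) = c * sphere_avg \<sigma> (p * q)"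
    unfolding sphere_avg_def scaleR_times_poly peval_scaleR by simp
next
  fix p :: "'a rpoly" assume p: "p \<in> forms m" "p \<noteq> 0"
  then obtain x0 where x0: "x0 \<in> sphere 0 1" "peval p x0 \<noteq> 0"
    using form_eq_zero_if_zero_on_sphere by blast
  define U where "U = {x. peval p x \<noteq> 0}"
  have "open U"
    unfolding U_def by (intro open_Collect_neq continuous_on_peval continuous_on_const)
  then have pos: "emeasure \<sigma> (U \<inter> sphere 0 1) \<noteq> 0"
    using uniform_sphere_measure_full_support[OF \<sigma>, of U x0] x0 by (simp add: U_def)
  have nonneg: "AE x in \<sigma>. 0 \<le> peval (p * p) x" by (simp add: peval_mult)
  have meas: "{x \<in> space \<sigma>. peval (p * p) x \<noteq> 0} \<in> sets \<sigma>"
    using borel_measurable_integrable[OF integrable_peval[OF \<sigma>, of "p * p"]] by measurable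
  have "sphere_avg \<sigma> (p * p) \<noteq> 0"
  proof
    assume "sphere_avg \<sigma> (p * p) = 0"
    then have "AE x in \<sigma>. peval (p * p) x = 0"
      unfolding sphere_avg_def
      using integral_nonneg_eq_0_iff_AE[OF integrable_peval[OF \<sigma>] nonneg] by simp
    then have "emeasure \<sigma> {x \<in> space \<sigma>. peval (p * p) x \<noteq> 0} = 0"
      using AE_iff_measurable[OF meas, of "\<lambda>x. peval (p * p) x = 0"] by simp
    moreover have "{x \<in> space \<sigma>. peval (p * p) x \<noteq> 0} = U \<inter> sphere 0 1"
      by (auto simp: space_uniform_sphere_measure[OF \<sigma>] U_def peval_mult)
    ultimately show False using pos by simp
  qed
  moreover have "sphere_avg \<sigma> (p * p) \<ge> 0"
    unfolding sphere_avg_def by (rule integral_nonneg_AE[OF nonneg])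
  ultimately show "sphere_avg \<sigma> (p * p) > 0" by simp
qed

section \<open>The inequality for sums of squares\<close>

lemma M_S_sum_squares: "M_S S (\<Sum>j\<in>J. (q j)\<^sup>2) = (\<Sum>j\<in>J. \<Sum>s\<in>S. (peval (q j) s)\<^sup>2)"
  unfolding M_S_def by (subst sum.swap) (simp add: peval_sum power2_eq_square peval_mult)

lemma sphere_avg_sum_squares:
  assumes "uniform_sphere_measure \<sigma>"
  shows "sphere_avg \<sigma> (\<Sum>j\<in>J. (q j)\<^sup>2) = (\<Sum>j\<in>J. sphere_avg \<sigma> (q j * q j))"
  unfolding sphere_avg_def peval_sum power2_eq_square
  by (rule Bochner_Integration.integral_sum) (rule integrable_peval[OF assms])

lemma square_in_Sq: "q \<in> forms d \<Longrightarrow> q * q \<in> Sq d"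
  unfolding Sq_def using forms_mult[of q d q d]
  by (simp add: mult_2, intro exI[of _ "1::nat"] exI[of _ "\<lambda>_. q"], simp add: power2_eq_square)

lemma linear_functional_on_product:
  assumes "linear_functional_on (forms (2 * d)) l"
  shows "symmetric_bilinear_on (forms d) (\<lambda>p q. l (p * q))"
proof -
  have "p * q \<in> forms (2 * d)" if "p \<in> forms d" "q \<in> forms d" for p q :: "'a rpoly"
    using forms_mult[OF that] by (simp add: mult_2)
  then show ?thesis
    unfolding symmetric_bilinear_on_def
    by (auto simp: linear_functional_on_def[of "forms d"] mult.commute[of _ "_ :: 'a rpoly"]
        distrib_left scaleR_times_poly linear_functional_on_add[OF assms]
        linear_functional_on_scaleR[OF assms])
qed

text \<open>The hypothesis on squares in \<open>quadratic_form_vanishing_on_kernel_bound\<close> holds for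
  \<open>b p q = l (p * q)\<close> with the evaluations at \<open>S\<close> as functionals, and for a sum of squares the two
  sums in its conclusion are \<open>M_S S p\<close> and \<open>sphere_avg \<sigma> p\<close>.\<close>

lemma functional_vanishing_on_Sq_on_bound:
  assumes S: "finite S" and \<sigma>: "uniform_sphere_measure \<sigma>"
    and l: "linear_functional_on (forms (2 * d)) l" and van: "\<And>p. p \<in> Sq_on d S \<Longrightarrow> l p = 0"
  shows "\<exists>C\<ge>0. \<forall>p\<in>Sq d. (l p)\<^sup>2 \<le> C * M_S S p * sphere_avg \<sigma> p"
proof -
  obtain B :: "'a rpoly set" where B: "finite B" "forms d = span B"
    using forms_finitely_spanned by blast
  have zero: "l (q * q) = 0" if "q \<in> forms d" "\<And>s. s \<in> S \<Longrightarrow> peval q s = 0" for q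
    using that square_in_Sq[OF that(1)] by (intro van) (auto simp: vanishing_def peval_mult)
  have ev: "linear_functional_on (forms d) (\<lambda>q. peval q s)" for s
    by (simp add: linear_functional_on_def peval_add peval_scaleR)
  have "\<exists>C\<ge>0. \<forall>(J :: nat set) q. (\<forall>j\<in>J. q j \<in> forms d) \<longrightarrow>
      (\<Sum>j\<in>J. l (q j * q j))\<^sup>2
        \<le> C * (\<Sum>j\<in>J. \<Sum>s\<in>S. (peval (q j) s)\<^sup>2) * (\<Sum>j\<in>J. sphere_avg \<sigma> (q j * q j))"
    unfolding B(2)
  proof (rule quadratic_form_vanishing_on_kernel_bound[where ev = "\<lambda>s q. peval q s"
        and t = "\<lambda>p q. sphere_avg \<sigma> (p * q)" and b = "\<lambda>p q. l (p * q)", OF S B(1)],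
      fold B(2))
    show "linear_functional_on (forms d) (\<lambda>q. peval q s)" for s
      by (rule ev)
    show "positive_definite_on (forms d) (\<lambda>p q. sphere_avg \<sigma> (p * q))"
      by (rule sphere_avg_positive_definite[OF \<sigma>])
    show "symmetric_bilinear_on (forms d) (\<lambda>p q. l (p * q))"
      by (rule linear_functional_on_product[OF l])
    show "l (q * q) = 0" if "q \<in> forms d" "\<And>s. s \<in> S \<Longrightarrow> peval q s = 0" for q
      by (rule zero[OF that])
  qed
  then obtain C where C: "C \<ge> 0"
    and bound: "\<forall>(J :: nat set) q. (\<forall>j\<in>J. q j \<in> forms d) \<longrightarrow>
      (\<Sum>j\<in>J. l (q j * q j))\<^sup>2
        \<le> C * (\<Sum>j\<in>J. \<Sum>s\<in>S. (peval (q j) s)\<^sup>2) * (\<Sum>j\<in>J. sphere_avg \<sigma> (q j * q j))"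
    by (elim exE conjE)
  have "(l p)\<^sup>2 \<le> C * M_S S p * sphere_avg \<sigma> p" if Sq: "p \<in> Sq d" for p
  proof -
    obtain N :: nat and q where q: "\<And>j. j < N \<Longrightarrow> q j \<in> forms d" and p: "p = (\<Sum>j<N. (q j)\<^sup>2)"
      using Sq by (auto simp: Sq_def)
    have "l p = (\<Sum>j<N. l (q j * q j))"
      unfolding p power2_eq_square using q forms_mult[of _ d _ d]
      by (intro linear_functional_on_sum[OF l subspace_forms]) (auto simp: mult_2)
    then show ?thesis
      unfolding p M_S_sum_squares sphere_avg_sum_squares[OF \<sigma>] using bound[rule_format, of "{..<N}" q] q by simp
  qed
  then show ?thesis using C by blast
qed

theorem theorem7p2:
  fixes S :: "(real ^ 'n::finite) set"
    and d k :: nat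
    and l :: "nat \<Rightarrow> 'n rpoly \<Rightarrow> real"
    and \<sigma> :: "(real ^ 'n) measure"
  assumes "d \<ge> 1"
    and "projective_points S"
    and "dim (Pos_on d S) > dim (Sq_on d S)"
    and "extra_constraints_basis d S k l"
    and "uniform_sphere_measure \<sigma>"
  shows "\<exists>\<alpha>>0. \<forall>p\<in>Sq d. \<alpha> * M_S S p * sphere_avg \<sigma> p - R_S k l p \<ge> 0"
proof -
  have S: "finite S" using assms(2) by (simp add: projective_points_def)
  have "\<exists>C\<ge>0. \<forall>p\<in>Sq d. (l i p)\<^sup>2 \<le> C * M_S S p * sphere_avg \<sigma> p" if "i \<in> {1..k}" for i
    using assms(4) that unfolding extra_constraints_basis_def
    by (intro functional_vanishing_on_Sq_on_bound[OF S assms(5)]) blast+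
  then obtain C where C: "\<And>i. i \<in> {1..k} \<Longrightarrow> C i \<ge> 0"
    and le: "\<And>i p. i \<in> {1..k} \<Longrightarrow> p \<in> Sq d \<Longrightarrow> (l i p)\<^sup>2 \<le> C i * M_S S p * sphere_avg \<sigma> p"
    by metis
  \<comment> \<open>The summand \<open>1\<close> keeps \<open>\<alpha>\<close> positive when all constants are zero.\<close>
  define \<alpha> where "\<alpha> = 1 + (\<Sum>i=1..k. C i)"
  have "(\<Sum>i=1..k. C i) \<ge> 0" using C by (intro sum_nonneg)
  then have pos: "\<alpha> > 0" by (simp add: \<alpha>_def)
  have "R_S k l p \<le> \<alpha> * M_S S p * sphere_avg \<sigma> p" if p: "p \<in> Sq d" for p
  proof -
    obtain N :: nat and q where "p = (\<Sum>j<N. (q j)\<^sup>2)" using p by (auto simp: Sq_def)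
    then have nonneg: "peval p x \<ge> 0" for x
      by (simp add: peval_sum power2_eq_square peval_mult sum_nonneg)
    have "M_S S p \<ge> 0" "sphere_avg \<sigma> p \<ge> 0"
      unfolding M_S_def sphere_avg_def using nonneg by (auto intro: sum_nonneg integral_nonneg_AE)
    then have MT: "M_S S p * sphere_avg \<sigma> p \<ge> 0" by simp
    have "R_S k l p \<le> (\<Sum>i=1..k. C i * M_S S p * sphere_avg \<sigma> p)"
      unfolding R_S_def by (intro sum_mono le p)
    also have "\<dots> = (\<alpha> - 1) * (M_S S p * sphere_avg \<sigma> p)"
      by (simp add: \<alpha>_def sum_distrib_right mult.assoc)
    also have "\<dots> \<le> \<alpha> * (M_S S p * sphere_avg \<sigma> p)"
      using MT by (intro mult_right_mono) auto
    finally show ?thesis by (simp add: mult.assoc)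
  qed
  then show ?thesis using pos by (intro exI[of _ \<alpha>]) simp
qed

end
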